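(* Let $(M^n,J,g)$ be an affine BSV torus with projection $\pi:M\to B$ and Chern torsion tensor $T$. Denote by ${\mathcal H}^{1,0}$ the $(1,0)$-part of the horizontal distribution of $\pi$. Then at every point of $M$, \[ im(T)\subset {\mathcal H}^{1,0}\subset ann(T). \] In particular, the Chern torsion satisfies \[ \sum_{s=1}^n T^{\ell}_{is}\,T^{s}_{jk}=0\qquad \forall\ 1\leq i,j,k,\ell\leq n, \] under any (local) unitary frame $e$, where $T(e_i,e_k)=\sum_j T^j_{ik}e_j$.
   Context: Chern torsion: at a point $p$ of a Hermitian manifold $(M^n,J,g)$, the torsion $T$ of the Chern connection restricts to a linear map $T:\Lambda^2 V_p\to V_p$, where $V_p=T_p^{1,0}M$ is the holomorphic tangent space. $im(T)\subset V_p$ is the image of this map, and $ann(T)=\{v\in V_p: T(v,w)=0\ \forall\, w\in V_p\}$. Space $Z_m$: for an oriented Euclidean real vector space $K$ of dimension $2m$, $Z_m=Z_m(K)\cong SO(2m)/U(m)$ is the set of all orthogonal complex structures $j$ on $K$ (linear isometries with $j^2=-1$) compatible with the orientation. It is a compact complex manifold; the complex structure on $T_jZ_m=\{\dot j \text{ skew-adjoint},\ \dot j j+j\dot j=0\}$ is $\dot j\mapsto j\dot j$. Equivalently, identifying $j$ with its $(-i)$-eigenspace in $K\otimes\mathbb C$, $Z_m$ is one component of the Grassmannian of maximal isotropic subspaces, a complex submanifold of $Gr(m,K\otimes\mathbb C)$. For $x\in Z_m$ write $J_x$ for the corresponding complex structure on $K$. Affine BSV torus of complex dimension $n$: a Hermitian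 manifold (up to holomorphic isometry) $(M,J,g)$, where $M=V/\Lambda$, $(V,g)$ is an oriented Euclidean vector space of real dimension $2n$, $\Lambda\subset V$ is a full lattice, and $J$ is built from the following data. There are an integer $0<r<n$ and an orthogonal decomposition $V=H\oplus K$ with $\dim_{\mathbb R}H=2r$; with $P_H:V\to H$ the orthogonal projection and $\Gamma=P_H(\Lambda)$, (1) $K$ is $\Lambda$-rational, i.e. $\Lambda_K=\Lambda\cap K$ is a full lattice in $K$ (hence $\Gamma$ is a full lattice in $H$); (2) $J_0$ is an orthogonal complex structure on $H$ making $B=H/\Gamma$ an abelian variety; (3) $f:B\to Z_{n-r}=Z_{n-r}(K)$ is a holomorphic map of generic (complex) rank $r$, where $K$ is oriented compatibly with $V$ and with the orientation of $H$ given by $J_0$. Then $J$ is the complex structure on $M$ induced by $J_{(h,k)}=J_0\oplus J_{f([h])}$ for $(h,k)\in H\oplus K=V$; it is integrable and compatible with the flat metric. The projection $\pi:M\to B$ is the holomorphic submersion induced by $P_H$. Its horizontal distribution is the translation-invariant ($J$-invariant) distribution $\mathcal H$ on $M$ determined by $H\subset V$, and ${\mathcal H}^{1,0}=(\mathcal H\otimes\mathbb C)\cap T^{1,0}M$. *)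

theory Defs
  imports "Jordan_Normal_Form.Determinant" "HOL-Analysis.Analysis"
begin

subsection \<open>Smooth maps\<close>

primrec Ck_on :: "nat \<Rightarrow> ('a::euclidean_space \<Rightarrow> 'b::real_normed_vector) \<Rightarrow> 'a set \<Rightarrow> bool" where
  "Ck_on 0 F S \<longleftrightarrow> continuous_on S F"
| "Ck_on (Suc k) F S \<longleftrightarrow>
     F differentiable_on S \<and> (\<forall>v. Ck_on k (\<lambda>x. frechet_derivative F (at x) v) S)"

text \<open>Only used for open sets \<^term>\<open>S\<close>.\<close>

definition smooth_on :: "('a::euclidean_space \<Rightarrow> 'b::real_normed_vector) \<Rightarrow> 'a set \<Rightarrow> bool" where
  "smooth_on F S \<longleftrightarrow> (\<forall>k. Ck_on k F S)"


subsection \<open>Lattices and flat tori\<close>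

definition full_lattice :: "'a::euclidean_space set \<Rightarrow> bool" where
  "full_lattice \<Lambda> \<longleftrightarrow>
     (\<exists>B. independent B \<and> span B = UNIV \<and>
          \<Lambda> = {\<Sum>b\<in>B. of_int (c b) *\<^sub>R b | c :: 'a \<Rightarrow> int. True})"

definition coset :: "'a::euclidean_space set \<Rightarrow> 'a \<Rightarrow> 'a set" where
  "coset \<Lambda> x = {x + l | l. l \<in> \<Lambda>}"

definition torus :: "'a::euclidean_space set \<Rightarrow> 'a set set" where
  "torus \<Lambda> = range (coset \<Lambda>)"

definition torus_open :: "'a::euclidean_space set \<Rightarrow> 'a set set \<Rightarrow> bool" where
  "torus_open \<Lambda> U \<longleftrightarrow> U \<subseteq> torus \<Lambda> \<and> open {x. coset \<Lambda> x \<in> U}"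

text \<open>Every tangent space of the torus \<open>V / \<Lambda>\<close> is identified with \<open>V\<close> by the differential of the
  quotient map. Vector fields are therefore maps from the torus to \<open>V\<close>. Smoothness and derivatives
  are those of the lift to \<open>V\<close>; the derivative does not depend on the representative
  chosen in the coset.\<close>

definition torus_smooth_on ::
  "'a::euclidean_space set \<Rightarrow> ('a set \<Rightarrow> 'b::real_normed_vector) \<Rightarrow> 'a set set \<Rightarrow> bool" where
  "torus_smooth_on \<Lambda> F U \<longleftrightarrow> smooth_on (\<lambda>x. F (coset \<Lambda> x)) {x. coset \<Lambda> x \<in> U}"

definition torus_deriv ::
  "'a::euclidean_space set \<Rightarrow> ('a set \<Rightarrow> 'b::real_normed_vector) \<Rightarrow> 'a set \<Rightarrow> 'a \<Rightarrow> 'b" where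
  "torus_deriv \<Lambda> F p v = frechet_derivative (\<lambda>x. F (coset \<Lambda> x)) (at (SOME x. x \<in> p)) v"


subsection \<open>Orientations and orthogonal complex structures\<close>

definition ordered_basis :: "'a::euclidean_space list \<Rightarrow> bool" where
  "ordered_basis bs \<longleftrightarrow> distinct bs \<and> independent (set bs) \<and> span (set bs) = UNIV"

definition same_orientation :: "'a::euclidean_space list \<Rightarrow> 'a list \<Rightarrow> bool" where
  "same_orientation bs cs \<longleftrightarrow> ordered_basis bs \<and> ordered_basis cs \<and>
     (\<exists>A :: real mat. A \<in> carrier_mat (length bs) (length bs) \<and> 0 < Determinant.det A \<and>
        (\<forall>i < length bs. bs ! i = (\<Sum>j < length cs. A $$ (i, j) *\<^sub>R cs ! j)))"

definition orientations :: "'a::euclidean_space list set set" where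
  "orientations = {bs. ordered_basis bs} // {(bs, cs). same_orientation bs cs}"

definition orthogonal_complex_structure :: "('a::euclidean_space \<Rightarrow>\<^sub>L 'a) \<Rightarrow> bool" where
  "orthogonal_complex_structure j \<longleftrightarrow>
     (\<forall>x y. blinfun_apply j x \<bullet> blinfun_apply j y = x \<bullet> y) \<and>
     (\<forall>x. blinfun_apply j (blinfun_apply j x) = - x)"

text \<open>The orientation of the bases \<open>x\<^sub>1, j x\<^sub>1, \<dots>, x\<^sub>m, j x\<^sub>m\<close>.\<close>

definition complex_orientation :: "('a::euclidean_space \<Rightarrow>\<^sub>L 'a) \<Rightarrow> 'a list set" where
  "complex_orientation j =
     {bs. \<exists>xs. same_orientation bs (concat (map (\<lambda>x. [x, blinfun_apply j x]) xs))}"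

text \<open>The orientation of the second factor which together with \<open>oH\<close> on the first factor gives
  the orientation \<open>oV\<close> of the product.\<close>

definition complementary_orientation ::
  "'h::euclidean_space list set \<Rightarrow> ('h \<times> 'k::euclidean_space) list set \<Rightarrow> 'k list set" where
  "complementary_orientation oH oV =
     {cs. ordered_basis cs \<and>
          (\<forall>bs\<in>oH. map (\<lambda>x. (x, 0)) bs @ map (\<lambda>y. (0, y)) cs \<in> oV)}"

text \<open>The space \<open>Z\<^sub>m\<close> of a Euclidean space of dimension \<open>2 m\<close> with orientation \<open>oK\<close>.\<close>

definition Z_space :: "'k::euclidean_space list set \<Rightarrow> ('k \<Rightarrow>\<^sub>L 'k) set" where
  "Z_space oK = {j. orthogonal_complex_structure j \<and> complex_orientation j = oK}"


subsection \<open>Abelian varieties\<close>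

definition holomorphic_fun ::
  "('h::euclidean_space \<Rightarrow>\<^sub>L 'h) \<Rightarrow> ('h \<Rightarrow> complex) \<Rightarrow> 'h set \<Rightarrow> bool" where
  "holomorphic_fun J0 s U \<longleftrightarrow> smooth_on s U \<and>
     (\<forall>x\<in>U. \<forall>v. frechet_derivative s (at x) (blinfun_apply J0 v) =
                \<i> * frechet_derivative s (at x) v)"

text \<open>The point of complex projective \<open>N\<close>-space with homogeneous coordinates \<open>z 0, \<dots>, z N\<close>, as a line.\<close>

definition proj_point :: "nat \<Rightarrow> (nat \<Rightarrow> complex) \<Rightarrow> (nat \<Rightarrow> complex) set" where
  "proj_point N z = {\<lambda>i. if i \<le> N then c * z i else 0 | c. True}"

text \<open>The complex torus \<open>H / \<Gamma>\<close> is an abelian variety if it embeds holomorphically in a projective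
  space: an injective immersion of a compact manifold is an embedding, and the image is algebraic by
  Chow's theorem. Locally \<open>\<phi> = [s 0 : \<dots> : s N]\<close>; the differential of \<open>\<phi>\<close> kills \<open>v\<close> iff the derivative
  of \<open>s\<close> in the direction \<open>v\<close> is a multiple of the value of \<open>s\<close>.\<close>

definition abelian_variety ::
  "'h::euclidean_space set \<Rightarrow> ('h \<Rightarrow>\<^sub>L 'h) \<Rightarrow> bool" where
  "abelian_variety \<Gamma> J0 \<longleftrightarrow> full_lattice \<Gamma> \<and>
     (\<exists>N (\<phi> :: 'h set \<Rightarrow> (nat \<Rightarrow> complex) set). inj_on \<phi> (torus \<Gamma>) \<and>
        (\<forall>x. \<exists>U (s :: nat \<Rightarrow> 'h \<Rightarrow> complex). open U \<and> x \<in> U \<and>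
           (\<forall>i\<le>N. holomorphic_fun J0 (s i) U) \<and>
           (\<forall>y\<in>U. (\<exists>i\<le>N. s i y \<noteq> 0) \<and>
                  \<phi> (coset \<Gamma> y) = proj_point N (\<lambda>i. s i y) \<and>
                  (\<forall>v. (\<exists>c. \<forall>i\<le>N. frechet_derivative (s i) (at y) v = c * s i y) \<longrightarrow> v = 0))))"


subsection \<open>Affine BSV tori\<close>

text \<open>The complex structure on the tangent space of \<open>Z\<^sub>m\<close> at \<open>j\<close> is composition with \<open>j\<close> from the left.\<close>

definition holomorphic_to_Z ::
  "'h::euclidean_space set \<Rightarrow> ('h \<Rightarrow>\<^sub>L 'h) \<Rightarrow> 'k::euclidean_space list set
     \<Rightarrow> ('h set \<Rightarrow> 'k \<Rightarrow>\<^sub>L 'k) \<Rightarrow> bool" where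
  "holomorphic_to_Z \<Gamma> J0 oK f \<longleftrightarrow>
     (\<forall>b\<in>torus \<Gamma>. f b \<in> Z_space oK) \<and>
     torus_smooth_on \<Gamma> f (torus \<Gamma>) \<and>
     (\<forall>b\<in>torus \<Gamma>. \<forall>v. torus_deriv \<Gamma> f b (blinfun_apply J0 v) = f b o\<^sub>L torus_deriv \<Gamma> f b v)"

text \<open>Complex rank \<open>r\<close> (real rank \<open>2 r\<close>) on a dense open set.\<close>

definition generic_complex_rank ::
  "'h::euclidean_space set \<Rightarrow> ('h set \<Rightarrow> 'b::real_normed_vector) \<Rightarrow> nat \<Rightarrow> bool" where
  "generic_complex_rank \<Gamma> f r \<longleftrightarrow>
     (\<exists>U. torus_open \<Gamma> U \<and> closure {x. coset \<Gamma> x \<in> U} = UNIV \<and>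
          (\<forall>b\<in>U. dim (range (torus_deriv \<Gamma> f b)) = 2 * r))"

text \<open>The orthogonal decomposition \<open>V = H \<oplus> K\<close> is the product of the Euclidean spaces \<^typ>\<open>'h\<close> and \<^typ>\<open>'k\<close>,
  and the projection to \<open>H\<close> is \<^const>\<open>fst\<close>. The data are the orientation \<open>oV\<close> of \<open>V\<close>, the lattice
  \<open>\<Lambda>\<close>, the complex structure \<open>J0\<close> of \<open>H\<close> and the map \<open>f\<close>.\<close>

definition affine_BSV_torus ::
  "nat \<Rightarrow> nat \<Rightarrow> ('h::euclidean_space \<times> 'k::euclidean_space) list set \<Rightarrow> ('h \<times> 'k) set
     \<Rightarrow> ('h \<Rightarrow>\<^sub>L 'h) \<Rightarrow> ('h set \<Rightarrow> 'k \<Rightarrow>\<^sub>L 'k) \<Rightarrow> bool" where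
  "affine_BSV_torus n r oV \<Lambda> J0 f \<longleftrightarrow>
     0 < r \<and> r < n \<and> DIM('h) = 2 * r \<and> DIM('k) = 2 * (n - r) \<and>
     oV \<in> orientations \<and>
     full_lattice \<Lambda> \<and>
     full_lattice {k. (0, k) \<in> \<Lambda>} \<and>
     orthogonal_complex_structure J0 \<and>
     abelian_variety (fst ` \<Lambda>) J0 \<and>
     holomorphic_to_Z (fst ` \<Lambda>) J0 (complementary_orientation (complex_orientation J0) oV) f \<and>
     generic_complex_rank (fst ` \<Lambda>) f r"

text \<open>For a point \<open>p = (h, k) + \<Lambda>\<close> of \<open>V / \<Lambda>\<close>, its projection to \<open>H / \<Gamma>\<close> is \<open>fst ` p = h + \<Gamma>\<close>.\<close>

definition BSV_J ::
  "('h::euclidean_space \<Rightarrow>\<^sub>L 'h) \<Rightarrow> ('h set \<Rightarrow> 'k::euclidean_space \<Rightarrow>\<^sub>L 'k)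
     \<Rightarrow> ('h \<times> 'k) set \<Rightarrow> 'h \<times> 'k \<Rightarrow> 'h \<times> 'k" where
  "BSV_J J0 f p = (\<lambda>(a, b). (blinfun_apply J0 a, blinfun_apply (f (fst ` p)) b))"


subsection \<open>Complexification\<close>

text \<open>The pair \<open>(x, y)\<close> stands for \<open>x + \<i> y\<close> in \<open>V \<otimes> \<complex>\<close>.\<close>

type_synonym 'a cplxn = "'a \<times> 'a"

definition cscale :: "complex \<Rightarrow> 'a::real_vector cplxn \<Rightarrow> 'a cplxn" where
  "cscale c z = (Re c *\<^sub>R fst z - Im c *\<^sub>R snd z, Re c *\<^sub>R snd z + Im c *\<^sub>R fst z)"

definition cconj :: "'a::real_vector cplxn \<Rightarrow> 'a cplxn" where
  "cconj z = (fst z, - snd z)"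

text \<open>Complex bilinear extensions of a real bilinear map and of the inner product.\<close>

definition cbilin :: "('a \<Rightarrow> 'a \<Rightarrow> 'b::real_vector) \<Rightarrow> 'a cplxn \<Rightarrow> 'a cplxn \<Rightarrow> 'b cplxn" where
  "cbilin \<beta> z w =
     (\<beta> (fst z) (fst w) - \<beta> (snd z) (snd w), \<beta> (fst z) (snd w) + \<beta> (snd z) (fst w))"

definition cinner :: "'a::real_inner cplxn \<Rightarrow> 'a cplxn \<Rightarrow> complex" where
  "cinner z w =
     Complex (fst z \<bullet> fst w - snd z \<bullet> snd w) (fst z \<bullet> snd w + snd z \<bullet> fst w)"

text \<open>The \<open>\<i>\<close>-eigenspace of the complex linear extension of \<open>j\<close>.\<close>

definition T10 :: "('a::real_vector \<Rightarrow> 'a) \<Rightarrow> 'a cplxn set" where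
  "T10 j = {z. (j (fst z), j (snd z)) = cscale \<i> z}"

definition horizontal :: "('h::real_vector \<times> 'k::real_vector) set" where
  "horizontal = {(h, 0) | h. True}"

definition horizontal10 ::
  "('h::real_vector \<times> 'k::real_vector \<Rightarrow> 'h \<times> 'k) \<Rightarrow> ('h \<times> 'k) cplxn set" where
  "horizontal10 j = (horizontal \<times> horizontal) \<inter> T10 j"


subsection \<open>Connections and Chern torsion on a flat torus with an almost complex structure\<close>

definition vector_field :: "'a::euclidean_space set \<Rightarrow> ('a set \<Rightarrow> 'a) \<Rightarrow> bool" where
  "vector_field \<Lambda> X \<longleftrightarrow> torus_smooth_on \<Lambda> X (torus \<Lambda>)"

definition smooth_function :: "'a::euclidean_space set \<Rightarrow> ('a set \<Rightarrow> real) \<Rightarrow> bool" where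
  "smooth_function \<Lambda> \<phi> \<longleftrightarrow> torus_smooth_on \<Lambda> \<phi> (torus \<Lambda>)"

definition lie_bracket ::
  "'a::euclidean_space set \<Rightarrow> ('a set \<Rightarrow> 'a) \<Rightarrow> ('a set \<Rightarrow> 'a) \<Rightarrow> 'a set \<Rightarrow> 'a" where
  "lie_bracket \<Lambda> X Y p = torus_deriv \<Lambda> Y p (X p) - torus_deriv \<Lambda> X p (Y p)"

type_synonym 'a covd = "('a set \<Rightarrow> 'a) \<Rightarrow> ('a set \<Rightarrow> 'a) \<Rightarrow> 'a set \<Rightarrow> 'a"

definition affine_connection :: "'a::euclidean_space set \<Rightarrow> 'a covd \<Rightarrow> bool" where
  "affine_connection \<Lambda> D \<longleftrightarrow>
     (\<forall>X Y. vector_field \<Lambda> X \<longrightarrow> vector_field \<Lambda> Y \<longrightarrow> vector_field \<Lambda> (D X Y)) \<and>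
     (\<forall>X X' Y. vector_field \<Lambda> X \<longrightarrow> vector_field \<Lambda> X' \<longrightarrow> vector_field \<Lambda> Y \<longrightarrow>
        (\<forall>p\<in>torus \<Lambda>. D (\<lambda>q. X q + X' q) Y p = D X Y p + D X' Y p)) \<and>
     (\<forall>\<phi> X Y. smooth_function \<Lambda> \<phi> \<longrightarrow> vector_field \<Lambda> X \<longrightarrow> vector_field \<Lambda> Y \<longrightarrow>
        (\<forall>p\<in>torus \<Lambda>. D (\<lambda>q. \<phi> q *\<^sub>R X q) Y p = \<phi> p *\<^sub>R D X Y p)) \<and>
     (\<forall>X Y Y'. vector_field \<Lambda> X \<longrightarrow> vector_field \<Lambda> Y \<longrightarrow> vector_field \<Lambda> Y' \<longrightarrow>
        (\<forall>p\<in>torus \<Lambda>. D X (\<lambda>q. Y q + Y' q) p = D X Y p + D X Y' p)) \<and>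
     (\<forall>\<phi> X Y. smooth_function \<Lambda> \<phi> \<longrightarrow> vector_field \<Lambda> X \<longrightarrow> vector_field \<Lambda> Y \<longrightarrow>
        (\<forall>p\<in>torus \<Lambda>. D X (\<lambda>q. \<phi> q *\<^sub>R Y q) p =
           \<phi> p *\<^sub>R D X Y p + torus_deriv \<Lambda> \<phi> p (X p) *\<^sub>R Y p))"

definition torsion ::
  "'a::euclidean_space set \<Rightarrow> 'a covd \<Rightarrow> ('a set \<Rightarrow> 'a) \<Rightarrow> ('a set \<Rightarrow> 'a) \<Rightarrow> 'a set \<Rightarrow> 'a" where
  "torsion \<Lambda> D X Y p = D X Y p - D Y X p - lie_bracket \<Lambda> X Y p"

text \<open>The value of the torsion tensor at \<open>p\<close> on tangent vectors, computed by extending them to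
  constant vector fields, and then extended complex bilinearly.\<close>

definition torsion_at ::
  "'a::euclidean_space set \<Rightarrow> 'a covd \<Rightarrow> 'a set \<Rightarrow> 'a \<Rightarrow> 'a \<Rightarrow> 'a" where
  "torsion_at \<Lambda> D p v w = torsion \<Lambda> D (\<lambda>_. v) (\<lambda>_. w) p"

definition ctorsion_at ::
  "'a::euclidean_space set \<Rightarrow> 'a covd \<Rightarrow> 'a set \<Rightarrow> 'a cplxn \<Rightarrow> 'a cplxn \<Rightarrow> 'a cplxn" where
  "ctorsion_at \<Lambda> D p = cbilin (torsion_at \<Lambda> D p)"

text \<open>The Chern connection of \<open>(V / \<Lambda>, J, \<bullet>)\<close> is the connection for which the metric and \<open>J\<close> are
  parallel and the torsion has no \<open>(1,1)\<close>-part.\<close>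

definition chern_connection ::
  "'a::euclidean_space set \<Rightarrow> ('a set \<Rightarrow> 'a \<Rightarrow> 'a) \<Rightarrow> 'a covd \<Rightarrow> bool" where
  "chern_connection \<Lambda> J D \<longleftrightarrow> affine_connection \<Lambda> D \<and>
     (\<forall>X Y W. vector_field \<Lambda> X \<longrightarrow> vector_field \<Lambda> Y \<longrightarrow> vector_field \<Lambda> W \<longrightarrow>
        (\<forall>p\<in>torus \<Lambda>. torus_deriv \<Lambda> (\<lambda>q. Y q \<bullet> W q) p (X p) = D X Y p \<bullet> W p + Y p \<bullet> D X W p)) \<and>
     (\<forall>X Y. vector_field \<Lambda> X \<longrightarrow> vector_field \<Lambda> Y \<longrightarrow>
        (\<forall>p\<in>torus \<Lambda>. D X (\<lambda>q. J q (Y q)) p = J p (D X Y p))) \<and>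
     (\<forall>p\<in>torus \<Lambda>. \<forall>z\<in>T10 (J p). \<forall>w\<in>T10 (J p). ctorsion_at \<Lambda> D p z (cconj w) = 0)"

text \<open>The image of the linear map which \<open>T\<close> induces on the second exterior power of \<open>V\<^sub>p\<close>.
  The elements of the exterior power are the finite sums of products of two vectors.\<close>

definition im_torsion :: "('a::real_vector cplxn \<Rightarrow> 'a cplxn \<Rightarrow> 'a cplxn) \<Rightarrow> 'a cplxn set \<Rightarrow> 'a cplxn set"
  where
  "im_torsion T Vp =
     {\<Sum>a<N. T (v a) (w a) | (N::nat) v w. \<forall>a<N. v a \<in> Vp \<and> w a \<in> Vp}"

definition ann_torsion :: "('a::real_vector cplxn \<Rightarrow> 'a cplxn \<Rightarrow> 'a cplxn) \<Rightarrow> 'a cplxn set \<Rightarrow> 'a cplxn set"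
  where
  "ann_torsion T Vp = {v \<in> Vp. \<forall>w\<in>Vp. T v w = 0}"

definition unitary_frame ::
  "nat \<Rightarrow> 'a::euclidean_space set \<Rightarrow> ('a set \<Rightarrow> 'a \<Rightarrow> 'a) \<Rightarrow> 'a set set
     \<Rightarrow> (nat \<Rightarrow> 'a set \<Rightarrow> 'a cplxn) \<Rightarrow> bool" where
  "unitary_frame n \<Lambda> J U e \<longleftrightarrow> torus_open \<Lambda> U \<and>
     (\<forall>i\<in>{1..n}. torus_smooth_on \<Lambda> (e i) U \<and> (\<forall>p\<in>U. e i p \<in> T10 (J p))) \<and>
     (\<forall>p\<in>U. \<forall>i\<in>{1..n}. \<forall>j\<in>{1..n}. cinner (e i p) (cconj (e j p)) = (if i = j then 1 else 0))"

end

theory Submission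
  imports Defs
begin

no_notation Matrix.scalar_prod (infix \<open>\<bullet>\<close> 70)

text \<open>In the trivialisation of the tangent bundle by constant vector fields the Chern connection
  \<open>D\<close> is a bilinear map \<open>A\<close> at each point. As the metric and \<open>J\<close> are parallel, \<open>A x\<close> is skew and its
  commutator with \<open>J\<close> is \<open>- G x\<close>, where \<open>G x\<close> is the derivative of \<open>J\<close> in the direction \<open>x\<close>.
  Holomorphicity of \<open>f\<close> gives \<open>G (J x) = J (G x)\<close>. Together with the vanishing of the \<open>(1,1)\<close>-part
  of the torsion \<open>T\<close>, this yields \<open>T (J x) y = J (T x y)\<close> and \<open>x \<bullet> J (T y w) = G x y \<bullet> w\<close>. Since \<open>J\<close>
  varies only in horizontal directions and only on \<open>K\<close>, \<open>G x y\<close> vanishes for vertical \<open>x\<close> and for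
  horizontal \<open>y\<close>. The former makes \<open>T\<close> horizontal, the latter makes \<open>T y w\<close> vanish for horizontal \<open>y\<close>.\<close>

subsection \<open>Smooth maps\<close>

text \<open>The derivative of \<open>c + L (F x)\<close> in a fixed direction has the same form with
  \<open>c = 0\<close>, hence the induction generalises over \<open>c\<close>. The constant is there
  because \<open>J\<close> applied to a fixed vector is a constant plus a linear image of
  \<open>f\<close>.\<close>

lemma Ck_on_affine_comp:
  assumes "bounded_linear L" "Ck_on k F UNIV"
  shows "Ck_on k (\<lambda>x. c + L (F x)) UNIV"
  using assms(2)
proof (induction k arbitrary: F c)
  case 0
  then show ?case
    by (simp add: continuous_on_add bounded_linear.continuous_on[OF assms(1)])
next
  case (Suc k)
  have F: "(F has_derivative frechet_derivative F (at x)) (at x)" for x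
    using Suc.prems by (simp add: differentiable_on_def frechet_derivative_works)
  have LF: "((\<lambda>x. c + L (F x)) has_derivative (\<lambda>v. L (frechet_derivative F (at x) v))) (at x)" for x
    using has_derivative_add[OF has_derivative_const bounded_linear.has_derivative[OF assms(1) F], of c x]
    by simp
  have "frechet_derivative (\<lambda>x. c + L (F x)) (at x) v = 0 + L (frechet_derivative F (at x) v)" for x v
    using frechet_derivative_at[OF LF, of x] by (metis add_0)
  moreover have "Ck_on k (\<lambda>x. 0 + L (frechet_derivative F (at x) v)) UNIV" for v
    using Suc.IH[of "\<lambda>x. frechet_derivative F (at x) v" 0] Suc.prems by simp
  ultimately show ?case
    using differentiableI[OF LF] by (simp add: differentiable_on_def)
qed

text \<open>Differentiating \<open>F (M x)\<close> in the direction \<open>v\<close> gives the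
  derivative of \<open>F\<close> in the fixed direction \<open>M v\<close>, again composed with
  \<open>M\<close>, so the induction generalises over \<open>F\<close>.\<close>

lemma Ck_on_comp_linear:
  fixes F :: "'a::euclidean_space \<Rightarrow> 'b::real_normed_vector"
    and M :: "'c::euclidean_space \<Rightarrow> 'a"
  assumes "bounded_linear M" "Ck_on k F UNIV"
  shows "Ck_on k (\<lambda>x. F (M x)) UNIV"
  using assms(2)
proof (induction k arbitrary: F)
  case 0
  then show ?case
    using continuous_on_compose2[of UNIV F UNIV M]
    by (simp add: linear_continuous_on[OF assms(1)])
next
  case (Suc k)
  have F: "(F has_derivative frechet_derivative F (at x)) (at x)" for x
    using Suc.prems by (simp add: differentiable_on_def frechet_derivative_works)
  have FM: "((\<lambda>x. F (M x)) has_derivative (\<lambda>v. frechet_derivative F (at (M x)) (M v))) (at x)" for x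
    using has_derivative_compose[OF bounded_linear_imp_has_derivative[OF assms(1)] F] .
  have "frechet_derivative (\<lambda>x. F (M x)) (at x) v = frechet_derivative F (at (M x)) (M v)" for x v
    using frechet_derivative_at[OF FM, of x] by metis
  moreover have "Ck_on k (\<lambda>x. frechet_derivative F (at (M x)) (M v)) UNIV" for v
    using Suc.IH[of "\<lambda>y. frechet_derivative F (at y) (M v)"] Suc.prems by auto
  ultimately show ?case
    using differentiableI[OF FM] by (simp add: differentiable_on_def)
qed

lemma Ck_on_const: "Ck_on k (\<lambda>x. c) UNIV"
  by (induction k arbitrary: c) auto

section \<open>Smooth maps on the torus, through their periodic lifts\<close>

lemma torus_smooth_on_torus:
  "torus_smooth_on \<Lambda> F (torus \<Lambda>) \<longleftrightarrow> (\<forall>k. Ck_on k (\<lambda>x. F (coset \<Lambda> x)) UNIV)"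
  by (simp add: torus_smooth_on_def smooth_on_def torus_def)

lemma torus_smooth_on_const: "torus_smooth_on \<Lambda> (\<lambda>_. c) (torus \<Lambda>)"
  by (simp add: torus_smooth_on_torus Ck_on_const)

lemma torus_smooth_on_affine_comp:
  assumes "bounded_linear L" "torus_smooth_on \<Lambda> F (torus \<Lambda>)"
  shows "torus_smooth_on \<Lambda> (\<lambda>p. c + L (F p)) (torus \<Lambda>)"
  using assms(2) Ck_on_affine_comp[OF assms(1)] unfolding torus_smooth_on_torus by blast

lemma torus_smooth_on_linear_comp:
  assumes "bounded_linear L" "torus_smooth_on \<Lambda> F (torus \<Lambda>)"
  shows "torus_smooth_on \<Lambda> (\<lambda>p. L (F p)) (torus \<Lambda>)"
  using torus_smooth_on_affine_comp[OF assms, of 0] by simp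

lemma torus_smooth_on_has_derivative:
  assumes "torus_smooth_on \<Lambda> F (torus \<Lambda>)"
  shows "((\<lambda>x. F (coset \<Lambda> x)) has_derivative frechet_derivative (\<lambda>x. F (coset \<Lambda> x)) (at y)) (at y)"
proof -
  have "Ck_on (Suc 0) (\<lambda>x. F (coset \<Lambda> x)) UNIV"
    using assms torus_smooth_on_torus by blast
  then show ?thesis
    by (simp add: differentiable_on_def frechet_derivative_works)
qed

lemma torus_deriv_const [simp]: "torus_deriv \<Lambda> (\<lambda>_. c) p v = 0"
  by (simp add: torus_deriv_def)

lemma torus_deriv_zero:
  assumes "torus_smooth_on \<Lambda> F (torus \<Lambda>)"
  shows "torus_deriv \<Lambda> F p 0 = 0"
  unfolding torus_deriv_def
  by (rule linear_0[OF has_derivative_linear[OF torus_smooth_on_has_derivative[OF assms]]])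

lemma torus_deriv_affine_comp:
  assumes L: "bounded_linear L" and F: "torus_smooth_on \<Lambda> F (torus \<Lambda>)"
  shows "torus_deriv \<Lambda> (\<lambda>q. c + L (F q)) p v = L (torus_deriv \<Lambda> F p v)"
proof -
  have "((\<lambda>x. c + L (F (coset \<Lambda> x))) has_derivative
      (\<lambda>v. L (frechet_derivative (\<lambda>x. F (coset \<Lambda> x)) (at y) v))) (at y)" for y
    using has_derivative_add[OF has_derivative_const
        bounded_linear.has_derivative[OF L torus_smooth_on_has_derivative[OF F]], of c y] by simp
  from frechet_derivative_at[OF this] show ?thesis
    unfolding torus_deriv_def by metis
qed

lemma torus_deriv_linear_comp:
  assumes "bounded_linear L" and "torus_smooth_on \<Lambda> F (torus \<Lambda>)"
  shows "torus_deriv \<Lambda> (\<lambda>q. L (F q)) p v = L (torus_deriv \<Lambda> F p v)"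
  using torus_deriv_affine_comp[OF assms, of 0] by simp


subsection \<open>Lattices\<close>

lemma full_lattice_0:
  assumes "full_lattice \<Lambda>"
  shows "0 \<in> \<Lambda>"
proof -
  obtain B where "\<Lambda> = {\<Sum>b\<in>B. of_int (c b) *\<^sub>R b | c :: 'a \<Rightarrow> int. True}"
    using assms by (auto simp: full_lattice_def)
  then show ?thesis
    by (auto intro!: exI[of _ "\<lambda>_. 0"])
qed

lemma full_lattice_add:
  assumes "full_lattice \<Lambda>" "x \<in> \<Lambda>" "y \<in> \<Lambda>"
  shows "x + y \<in> \<Lambda>"
proof -
  obtain B where B: "\<Lambda> = {\<Sum>b\<in>B. of_int (c b) *\<^sub>R b | c :: 'a \<Rightarrow> int. True}"
    using assms by (auto simp: full_lattice_def)
  obtain c d where "x = (\<Sum>b\<in>B. of_int (c b) *\<^sub>R b)" "y = (\<Sum>b\<in>B. of_int (d b) *\<^sub>R b)"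
    using assms by (auto simp: B)
  then have "x + y = (\<Sum>b\<in>B. of_int (c b + d b) *\<^sub>R b)"
    by (simp add: sum.distrib scaleR_add_left)
  then show ?thesis
    unfolding B by (auto intro!: exI[of _ "\<lambda>b. c b + d b"])
qed

lemma full_lattice_uminus:
  assumes "full_lattice \<Lambda>" "x \<in> \<Lambda>"
  shows "- x \<in> \<Lambda>"
proof -
  obtain B where B: "\<Lambda> = {\<Sum>b\<in>B. of_int (c b) *\<^sub>R b | c :: 'a \<Rightarrow> int. True}"
    using assms by (auto simp: full_lattice_def)
  obtain c where "x = (\<Sum>b\<in>B. of_int (c b) *\<^sub>R b)"
    using assms by (auto simp: B)
  then have "- x = (\<Sum>b\<in>B. of_int (- c b) *\<^sub>R b)"
    by (simp add: sum_negf)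
  then show ?thesis
    unfolding B by (auto intro!: exI[of _ "\<lambda>b. - c b"])
qed

lemma coset_shift:
  assumes "full_lattice \<Lambda>" "l \<in> \<Lambda>"
  shows "coset \<Lambda> (x + l) = coset \<Lambda> x"
proof -
  have "\<exists>m'. x + l + m = x + m' \<and> m' \<in> \<Lambda>" if "m \<in> \<Lambda>" for m
    using full_lattice_add[OF assms that] by (metis add.assoc)
  moreover have "\<exists>m'. x + m = x + l + m' \<and> m' \<in> \<Lambda>" if "m \<in> \<Lambda>" for m
    using full_lattice_add[OF assms(1) full_lattice_uminus[OF assms] that]
    by (intro exI[of _ "- l + m"]) (simp add: add.assoc)
  ultimately show ?thesis
    unfolding coset_def by blast
qed

text \<open>The lift of \<open>F\<close> is invariant under lattice translations, so the chain rule
  for a translation identifies its derivatives at the two points. This frees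
  \<open>torus_deriv\<close> from the representative chosen by \<open>SOME\<close>.\<close>

lemma frechet_derivative_coset:
  assumes \<Lambda>: "full_lattice \<Lambda>" and F: "torus_smooth_on \<Lambda> F (torus \<Lambda>)" and y: "y \<in> coset \<Lambda> x"
  shows "frechet_derivative (\<lambda>x. F (coset \<Lambda> x)) (at y) = frechet_derivative (\<lambda>x. F (coset \<Lambda> x)) (at x)"
proof -
  obtain l where l: "l \<in> \<Lambda>" "y = x + l"
    using y by (auto simp: coset_def)
  have "((\<lambda>x. x + l) has_derivative (\<lambda>v. v)) (at x)"
    by (auto intro!: derivative_eq_intros)
  from has_derivative_compose[OF this torus_smooth_on_has_derivative[OF F]]
  have "((\<lambda>x. F (coset \<Lambda> x)) has_derivative frechet_derivative (\<lambda>x. F (coset \<Lambda> x)) (at y)) (at x)"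
    by (simp add: coset_shift[OF \<Lambda> l(1)] l(2))
  from frechet_derivative_at[OF this] show ?thesis .
qed

lemma torus_deriv_coset:
  assumes "full_lattice \<Lambda>" "torus_smooth_on \<Lambda> F (torus \<Lambda>)"
  shows "torus_deriv \<Lambda> F (coset \<Lambda> x) v = frechet_derivative (\<lambda>x. F (coset \<Lambda> x)) (at x) v"
proof -
  have "x \<in> coset \<Lambda> x"
    using full_lattice_0[OF assms(1)] by (auto simp: coset_def)
  then have "(SOME y. y \<in> coset \<Lambda> x) \<in> coset \<Lambda> x"
    by (rule someI)
  from frechet_derivative_coset[OF assms this] show ?thesis
    unfolding torus_deriv_def by simp
qed

section \<open>Pullback from the base torus along the projection\<close>

lemma fst_coset: "fst ` coset \<Lambda> x = coset (fst ` \<Lambda>) (fst x)"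
  by (force simp: coset_def image_iff)

lemma torus_smooth_on_fst:
  fixes \<Lambda> :: "('h::euclidean_space \<times> 'k::euclidean_space) set"
  assumes "torus_smooth_on (fst ` \<Lambda>) F (torus (fst ` \<Lambda>))"
  shows "torus_smooth_on \<Lambda> (\<lambda>p. F (fst ` p)) (torus \<Lambda>)"
  using assms Ck_on_comp_linear[OF bounded_linear_fst]
  by (auto simp: torus_smooth_on_torus fst_coset)

lemma torus_deriv_fst:
  fixes \<Lambda> :: "('h::euclidean_space \<times> 'k::euclidean_space) set"
  assumes \<Lambda>: "full_lattice \<Lambda>" "full_lattice (fst ` \<Lambda>)"
    and F: "torus_smooth_on (fst ` \<Lambda>) F (torus (fst ` \<Lambda>))" and p: "p \<in> torus \<Lambda>"
  shows "torus_deriv \<Lambda> (\<lambda>p. F (fst ` p)) p v = torus_deriv (fst ` \<Lambda>) F (fst ` p) (fst v)"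
proof -
  obtain x where x: "p = coset \<Lambda> x"
    using p by (auto simp: torus_def)
  let ?F = "\<lambda>x. F (coset (fst ` \<Lambda>) x)"
  have "((\<lambda>x. ?F (fst x)) has_derivative (\<lambda>v. frechet_derivative ?F (at (fst x)) (fst v))) (at x)"
    using has_derivative_compose[OF bounded_linear_imp_has_derivative[OF bounded_linear_fst]
        torus_smooth_on_has_derivative[OF F]] .
  from frechet_derivative_at[OF this]
  have "frechet_derivative (\<lambda>x. ?F (fst x)) (at x) v = frechet_derivative ?F (at (fst x)) (fst v)"
    by metis
  \<comment> \<open>The representatives chosen on the two tori need not correspond under
    \<open>fst\<close>, so both derivatives are moved to \<open>x\<close> and
    \<open>fst x\<close>.\<close>
  then show ?thesis
    using torus_deriv_coset[OF \<Lambda>(1) torus_smooth_on_fst[OF F], of x v]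
      torus_deriv_coset[OF \<Lambda>(2) F, of "fst x" "fst v"]
    by (simp add: x fst_coset)
qed


subsection \<open>Connections in the constant trivialisation\<close>

lemma affine_connectionD:
  assumes "affine_connection \<Lambda> D" and "p \<in> torus \<Lambda>"
    and "vector_field \<Lambda> X" "vector_field \<Lambda> Y"
  shows affine_connection_add_left:
      "vector_field \<Lambda> X' \<Longrightarrow> D (\<lambda>q. X q + X' q) Y p = D X Y p + D X' Y p"
    and affine_connection_scale_left:
      "smooth_function \<Lambda> \<phi> \<Longrightarrow> D (\<lambda>q. \<phi> q *\<^sub>R X q) Y p = \<phi> p *\<^sub>R D X Y p"
    and affine_connection_add_right:
      "vector_field \<Lambda> Y' \<Longrightarrow> D X (\<lambda>q. Y q + Y' q) p = D X Y p + D X Y' p"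
    and affine_connection_Leibniz:
      "smooth_function \<Lambda> \<phi> \<Longrightarrow>
        D X (\<lambda>q. \<phi> q *\<^sub>R Y q) p = \<phi> p *\<^sub>R D X Y p + torus_deriv \<Lambda> \<phi> p (X p) *\<^sub>R Y p"
proof -
  note D = assms(1)[unfolded affine_connection_def, THEN conjunct2]
  show "vector_field \<Lambda> X' \<Longrightarrow> D (\<lambda>q. X q + X' q) Y p = D X Y p + D X' Y p"
    by (rule D[THEN conjunct1, rule_format, OF assms(3) _ assms(4,2)])
  show "smooth_function \<Lambda> \<phi> \<Longrightarrow> D (\<lambda>q. \<phi> q *\<^sub>R X q) Y p = \<phi> p *\<^sub>R D X Y p"
    by (rule D[THEN conjunct2, THEN conjunct1, rule_format, OF _ assms(3,4,2)])
  show "vector_field \<Lambda> Y' \<Longrightarrow> D X (\<lambda>q. Y q + Y' q) p = D X Y p + D X Y' p"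
    by (rule D[THEN conjunct2, THEN conjunct2, THEN conjunct1, rule_format, OF assms(3,4) _ assms(2)])
  show "smooth_function \<Lambda> \<phi> \<Longrightarrow>
      D X (\<lambda>q. \<phi> q *\<^sub>R Y q) p = \<phi> p *\<^sub>R D X Y p + torus_deriv \<Lambda> \<phi> p (X p) *\<^sub>R Y p"
    by (rule D[THEN conjunct2, THEN conjunct2, THEN conjunct2, rule_format, OF _ assms(3,4,2)])
qed

lemma vector_field_const: "vector_field \<Lambda> (\<lambda>_. x)"
  by (simp add: vector_field_def torus_smooth_on_const)

lemma bilinear_connection_const:
  assumes D: "affine_connection \<Lambda> D" and p: "p \<in> torus \<Lambda>"
  shows "bilinear (\<lambda>x y. D (\<lambda>_. x) (\<lambda>_. y) p)"
proof -
  \<comment> \<open>Constant coefficients turn linearity over functions into real linearity; the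
    derivative term of the Leibniz rule vanishes for them.\<close>
  have const: "smooth_function \<Lambda> (\<lambda>_. c)" for c
    by (simp add: smooth_function_def torus_smooth_on_const)
  note D_simps = affine_connection_add_left[OF D p vector_field_const vector_field_const vector_field_const]
    affine_connection_scale_left[OF D p vector_field_const vector_field_const const]
    affine_connection_add_right[OF D p vector_field_const vector_field_const vector_field_const]
    affine_connection_Leibniz[OF D p vector_field_const vector_field_const const]
  show ?thesis
    by (simp add: bilinear_def linear_iff D_simps)
qed

lemma torsion_at_const:
  "torsion_at \<Lambda> D p x y = D (\<lambda>_. x) (\<lambda>_. y) p - D (\<lambda>_. y) (\<lambda>_. x) p"
  by (simp add: torsion_at_def torsion_def lie_bracket_def)

text \<open>Expand \<open>Y\<close> in the standard basis with coefficient functions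
  \<open>Y q \<bullet> b\<close>: the Leibniz rule yields the values of \<open>D\<close> on constant
  fields plus the derivatives of the coefficients.\<close>

lemma connection_expand:
  fixes D :: "'a::euclidean_space covd"
  assumes D: "affine_connection \<Lambda> D" and p: "p \<in> torus \<Lambda>" and Y: "vector_field \<Lambda> Y"
  shows "D (\<lambda>_. x) Y p = D (\<lambda>_. x) (\<lambda>_. Y p) p + torus_deriv \<Lambda> Y p x"
proof -
  let ?A = "\<lambda>y. D (\<lambda>_. x) (\<lambda>_. y) p"
  have linA: "linear ?A"
    using bilinear_connection_const[OF D p] by (simp add: bilinear_def)
  have smooth: "smooth_function \<Lambda> (\<lambda>q. Y q \<bullet> b)" for b
    using torus_smooth_on_linear_comp[OF bounded_linear_inner_left] Y
    by (auto simp: smooth_function_def vector_field_def)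
  \<comment> \<open>Stated for every \<open>B\<close>, since the induction below needs the partial
    sums to be smooth fields.\<close>
  have "linear (\<lambda>v. \<Sum>b\<in>B. (v \<bullet> b) *\<^sub>R b)" for B :: "'a set"
    by (auto simp: linear_iff inner_add_left scaleR_add_left sum.distrib scaleR_sum_right)
  then have "bounded_linear (\<lambda>v. \<Sum>b\<in>B. (v \<bullet> b) *\<^sub>R b)" for B :: "'a set"
    by (rule linear_conv_bounded_linear[THEN iffD1])
  then have proj: "vector_field \<Lambda> (\<lambda>q. \<Sum>b\<in>B. (Y q \<bullet> b) *\<^sub>R b)" for B
    using torus_smooth_on_linear_comp Y unfolding vector_field_def by blast
  have coord: "D (\<lambda>_. x) (\<lambda>q. (Y q \<bullet> b) *\<^sub>R b) p
      = (Y p \<bullet> b) *\<^sub>R ?A b + (torus_deriv \<Lambda> Y p x \<bullet> b) *\<^sub>R b" for b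
  proof -
    have "D (\<lambda>_. x) (\<lambda>q. (Y q \<bullet> b) *\<^sub>R b) p
        = (Y p \<bullet> b) *\<^sub>R ?A b + torus_deriv \<Lambda> (\<lambda>q. Y q \<bullet> b) p x *\<^sub>R b"
      by (rule affine_connection_Leibniz[OF D p vector_field_const vector_field_const smooth])
    then show ?thesis
      by (simp add: torus_deriv_linear_comp[OF bounded_linear_inner_left Y[unfolded vector_field_def]])
  qed
  have "D (\<lambda>_. x) (\<lambda>q. \<Sum>b\<in>B. (Y q \<bullet> b) *\<^sub>R b) p
      = (\<Sum>b\<in>B. (Y p \<bullet> b) *\<^sub>R ?A b + (torus_deriv \<Lambda> Y p x \<bullet> b) *\<^sub>R b)" if "finite B" for B
    using that
  proof (induction B)
    case empty
    \<comment> \<open>The zero field is a constant field, so \<open>?A 0 = 0\<close>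
      applies.\<close>
    then show ?case
      using linear_0[OF linA] by simp
  next
    case (insert b B)
    have "vector_field \<Lambda> (\<lambda>q. (Y q \<bullet> b) *\<^sub>R b)"
      using proj[of "{b}"] by simp
    then have "D (\<lambda>_. x) (\<lambda>q. (Y q \<bullet> b) *\<^sub>R b + (\<Sum>b\<in>B. (Y q \<bullet> b) *\<^sub>R b)) p
        = D (\<lambda>_. x) (\<lambda>q. (Y q \<bullet> b) *\<^sub>R b) p + D (\<lambda>_. x) (\<lambda>q. \<Sum>b\<in>B. (Y q \<bullet> b) *\<^sub>R b) p"
      by (rule affine_connection_add_right[OF D p vector_field_const _ proj])
    then show ?case
      using insert coord[of b] by simp
  qed
  from this[OF finite_Basis]
  have "D (\<lambda>_. x) Y p = (\<Sum>b\<in>Basis. (Y p \<bullet> b) *\<^sub>R ?A b) + torus_deriv \<Lambda> Y p x"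
    by (simp add: euclidean_representation sum.distrib)
  also have "(\<Sum>b\<in>Basis. (Y p \<bullet> b) *\<^sub>R ?A b) = ?A (\<Sum>b\<in>Basis. (Y p \<bullet> b) *\<^sub>R b)"
    by (simp add: linear_sum[OF linA] linear_cmul[OF linA])
  finally show ?thesis
    by (simp add: euclidean_representation)
qed


subsection \<open>The torsion at a point\<close>

lemma skew_of_isometry:
  fixes J :: "'a::real_inner \<Rightarrow> 'a"
  assumes iso: "\<And>x y. J x \<bullet> J y = x \<bullet> y" and JJ: "\<And>x. J (J x) = - x"
  shows "J x \<bullet> y = - (x \<bullet> J y)"
proof -
  have "J x \<bullet> y = J (J x) \<bullet> J y"
    by (simp only: iso)
  then show ?thesis
    by (simp add: JJ)
qed

text \<open>\<open>A\<close> is the connection on constant vectors and \<open>G x\<close> the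
  derivative of \<open>J\<close> along \<open>x\<close>. The type condition and \<open>GJ\<close>
  express \<open>A (J y)\<close> through \<open>A y\<close> and \<open>G\<close>; skewness of
  \<open>A\<close> and of \<open>G x\<close> then determines \<open>J (T y w)\<close> much as in the
  Koszul formula.\<close>

lemma torsion_identities:
  fixes A :: "'a::real_inner \<Rightarrow> 'a \<Rightarrow> 'a" and J :: "'a \<Rightarrow> 'a"
  assumes A: "bilinear A" and J: "linear J"
    and Askew: "\<And>x y w. A x y \<bullet> w = - (y \<bullet> A x w)"
    and iso: "\<And>x y. J x \<bullet> J y = x \<bullet> y" and JJ: "\<And>x. J (J x) = - x"
    and G: "\<And>x y. G x y = J (A x y) - A x (J y)"
    and GJ: "\<And>x y. G (J x) y = J (G x y)"
    and T: "\<And>x y. T x y = A x y - A y x"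
    and T11: "\<And>x y. T (J x) (J y) = - T x y"
  shows torsion_complex_linear: "T (J x) y = J (T x y)"
    and torsion_inner: "x \<bullet> J (T y w) = G x y \<bullet> w"
proof -
  note Jl = linear_add[OF J] linear_diff[OF J] linear_neg[OF J]
  note Al = bilinear_lneg[OF A] bilinear_rneg[OF A]
  note Jskew = skew_of_isometry[of J, OF iso JJ]
  \<comment> \<open>This is \<open>T11\<close> with \<open>J y\<close> in place of
    \<open>y\<close>.\<close>
  have T_swap: "T (J x) y = T x (J y)" for x y
  proof -
    have "- T (J x) y = T (J x) (J (J y))"
      by (simp add: JJ T Al)
    then show ?thesis
      by (simp add: T11)
  qed
  \<comment> \<open>The failure of \<open>A\<close> to be complex linear in its first argument is a
    derivative of \<open>J\<close>. Complex linearity of \<open>T\<close> is this identity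
    rearranged by the definition of \<open>G\<close>.\<close>
  have E: "A (J y) x - J (A y x) = - G x y" for x y
  proof -
    have 1: "G y x + (A (J x) y - J (A x y)) + G x y + (A (J y) x - J (A y x)) = 0" for x y
    proof -
      have "G y x + (A (J x) y - J (A x y)) + G x y + (A (J y) x - J (A y x)) = T (J x) y - T x (J y)"
        by (simp add: T G)
      then show ?thesis
        by (simp add: T_swap)
    qed
    \<comment> \<open>Up to an application of \<open>J\<close>, replacing one argument by its image under \<open>J\<close> changes the sign
      of two of the four terms, so both pairs cancel separately.\<close>
    from 1[of y "J x"]
    have "J (G x y) - J (G y x) + J (A (J y) x - J (A y x)) - J (A (J x) y - J (A x y)) = 0"
      using GJ[of x y] GJ[of y x] by (simp add: G Jl JJ Al algebra_simps)
    \<comment> \<open>Applying \<open>J\<close> once more removes the outer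
      \<open>J\<close>.\<close>
    then have "J (J (G x y - G y x + (A (J y) x - J (A y x)) - (A (J x) y - J (A x y)))) = 0"
      using linear_0[OF J] by (simp add: Jl algebra_simps)
    then have 2: "G x y - G y x + (A (J y) x - J (A y x)) - (A (J x) y - J (A x y)) = 0"
      by (simp only: JJ neg_equal_0_iff_equal)
    have "2 *\<^sub>R (G x y + (A (J y) x - J (A y x)))
        = (G x y - G y x + (A (J y) x - J (A y x)) - (A (J x) y - J (A x y)))
        + (G y x + (A (J x) y - J (A x y)) + G x y + (A (J y) x - J (A y x)))"
      unfolding scaleR_2 by (simp add: algebra_simps)
    also have "\<dots> = 0"
      by (simp only: 1 2 add_0)
    finally have "A (J y) x - J (A y x) + G x y = 0"
      by (simp only: scaleR_eq_0_iff add.commute) simp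
    then show ?thesis
      by (simp only: eq_neg_iff_add_eq_0)
  qed
  show "T (J x) y = J (T x y)"
    using E[of x y] by (simp add: T G Jl algebra_simps)
  \<comment> \<open>Two instances of \<open>E\<close> are paired with \<open>w\<close> and
    \<open>x\<close> and added. By skewness the \<open>A (J y)\<close> terms cancel; moving
    \<open>J\<close> across the product leaves \<open>x \<bullet> J (A y w)\<close> twice, up to
    values of \<open>G\<close>.\<close>
  have AJ: "2 * (x \<bullet> J (A y w)) = G x y \<bullet> w + x \<bullet> G w y + x \<bullet> G y w" for x y w
  proof -
    have "A (J y) x \<bullet> w - J (A y x) \<bullet> w = - (G x y \<bullet> w)"
      using arg_cong[OF E[of y x], of "\<lambda>v. v \<bullet> w"] by (simp add: inner_diff_left)
    moreover have "x \<bullet> A (J y) w - x \<bullet> J (A y w) = - (x \<bullet> G w y)"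
      using arg_cong[OF E[of y w], of "\<lambda>v. x \<bullet> v"] by (simp add: inner_diff_right)
    moreover have "J (A y x) \<bullet> w = x \<bullet> A y (J w)"
      by (simp add: Jskew Askew)
    moreover have "x \<bullet> G y w = x \<bullet> J (A y w) - x \<bullet> A y (J w)"
      by (simp add: G inner_diff_right)
    ultimately show ?thesis
      by (simp add: Askew[of "J y"])
  qed
  have "G x y \<bullet> w = - (y \<bullet> G x w)"
    by (simp add: G inner_diff_left inner_diff_right Jskew Askew)
  then have "G x y \<bullet> w = - (G x w \<bullet> y)"
    by (simp add: inner_commute)
  moreover have "x \<bullet> J (T y w) = x \<bullet> J (A y w) - x \<bullet> J (A w y)"
    by (simp add: T Jl inner_diff_right)
  \<comment> \<open>Subtract from \<open>AJ\<close> its copy with \<open>y\<close> and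
    \<open>w\<close> exchanged: the terms \<open>x \<bullet> G w y + x \<bullet> G y w\<close>
    cancel by symmetry, and skewness of \<open>G x\<close> makes the other two add up.\<close>
  ultimately show "x \<bullet> J (T y w) = G x y \<bullet> w"
    using AJ[of x y w] AJ[of x w y] by linarith
qed

section \<open>Vectors of type (1,0) and complex bilinear extensions\<close>

lemma T10_iff: "z \<in> T10 J \<longleftrightarrow> J (fst z) = - snd z \<and> J (snd z) = fst z"
  by (auto simp: T10_def cscale_def)

lemma T10_sum:
  assumes "linear J" "\<And>a. a \<in> S \<Longrightarrow> z a \<in> T10 J"
  shows "sum z S \<in> T10 J"
  using assms by (simp add: T10_iff fst_sum snd_sum linear_sum[OF assms(1)] sum_negf)

text \<open>A vector of type (1,0) is \<open>x - i J x\<close> with real part \<open>x\<close>. As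
  \<open>\<beta>\<close> is complex linear in both arguments, the four terms of the expansion agree
  in pairs, and the value has the form \<open>2 (u - i J u)\<close>.\<close>

lemma cbilin_T10:
  assumes \<beta>: "bilinear \<beta>" and \<beta>J: "\<And>x y. \<beta> (J x) y = J (\<beta> x y)" "\<And>x y. \<beta> x (J y) = J (\<beta> x y)"
    and J: "linear J" and JJ: "\<And>x. J (J x) = - x" and zw: "z \<in> T10 J" "w \<in> T10 J"
  shows "cbilin \<beta> z w = (2 *\<^sub>R \<beta> (fst z) (fst w), - (2 *\<^sub>R J (\<beta> (fst z) (fst w))))"
proof -
  have "snd z = - J (fst z)" "snd w = - J (fst w)"
    using zw by (auto simp: T10_iff)
  then show ?thesis
    by (simp add: cbilin_def \<beta>J JJ linear_neg[OF J] bilinear_lneg[OF \<beta>] bilinear_rneg[OF \<beta>] scaleR_2)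
qed

lemma cbilin_cscale_right:
  assumes "bilinear \<beta>"
  shows "cbilin \<beta> z (cscale c w) = cscale c (cbilin \<beta> z w)"
  by (simp add: cbilin_def cscale_def bilinear_radd[OF assms] bilinear_rsub[OF assms]
      bilinear_rmul[OF assms] algebra_simps)

lemma cbilin_sum_right:
  assumes "bilinear \<beta>"
  shows "cbilin \<beta> z (\<Sum>a\<in>S. w a) = (\<Sum>a\<in>S. cbilin \<beta> z (w a))"
proof -
  have "linear (cbilin \<beta> z)"
    by (auto simp: linear_iff cbilin_def bilinear_radd[OF assms] bilinear_rmul[OF assms]
        algebra_simps)
  then show ?thesis
    by (rule linear_sum)
qed

lemma cinner_cscale_left: "cinner (cscale c z) w = c * cinner z w"
  by (simp add: cinner_def cscale_def complex_eq_iff algebra_simps)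

lemma cinner_sum_left: "cinner (\<Sum>a\<in>S. z a) w = (\<Sum>a\<in>S. cinner (z a) w)"
proof -
  have "linear (\<lambda>z. cinner z w)"
    by (auto simp: linear_iff cinner_def complex_eq_iff algebra_simps)
  then show ?thesis
    by (rule linear_sum)
qed


subsection \<open>The Chern torsion of an affine BSV torus\<close>

text \<open>This is the real part of the (1,1)-condition on \<open>x - i J x\<close> and the
  conjugate of \<open>y - i J y\<close>.\<close>

lemma chern_torsion_vanishes_11:
  assumes "chern_connection \<Lambda> J D" "p \<in> torus \<Lambda>" "linear (J p)" "\<And>x. J p (J p x) = - x"
  shows "torsion_at \<Lambda> D p (J p x) (J p y) = - torsion_at \<Lambda> D p x y"
proof -
  have D: "affine_connection \<Lambda> D"
    using assms(1) by (simp add: chern_connection_def)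
  note b = bilinear_connection_const[OF D assms(2)]
  have T10: "(x, - J p x) \<in> T10 (J p)" for x
    by (simp add: T10_iff assms linear_neg[OF assms(3)])
  have "ctorsion_at \<Lambda> D p (x, - J p x) (cconj (y, - J p y)) = 0"
    using assms(1,2) T10 unfolding chern_connection_def by blast
  then have "torsion_at \<Lambda> D p x y + torsion_at \<Lambda> D p (J p x) (J p y) = 0"
    by (simp add: ctorsion_at_def cbilin_def cconj_def torsion_at_const
        bilinear_lneg[OF b] bilinear_rneg[OF b] zero_prod_def)
  then show ?thesis
    by (metis add_eq_0_iff)
qed

section \<open>The connection and its torsion at a fixed point \<open>p\<close>\<close>

context
  fixes n r :: nat
    and oV :: "('h::euclidean_space \<times> 'k::euclidean_space) list set"
    and \<Lambda> :: "('h \<times> 'k) set"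
    and J0 :: "'h \<Rightarrow>\<^sub>L 'h"
    and f :: "'h set \<Rightarrow> 'k \<Rightarrow>\<^sub>L 'k"
    and D :: "('h \<times> 'k) covd"
    and p :: "('h \<times> 'k) set"
  assumes BSV: "affine_BSV_torus n r oV \<Lambda> J0 f"
    and chern: "chern_connection \<Lambda> (BSV_J J0 f) D"
    and p: "p \<in> torus \<Lambda>"
begin

private abbreviation (input) "J \<equiv> BSV_J J0 f p"
private abbreviation (input) "T \<equiv> torsion_at \<Lambda> D p"
private abbreviation (input) "df \<equiv> torus_deriv (fst ` \<Lambda>) f (fst ` p)"

private lemma fst_p: "fst ` p \<in> torus (fst ` \<Lambda>)"
  using p by (auto simp: torus_def fst_coset)

private lemma lattices: "full_lattice \<Lambda>" "full_lattice (fst ` \<Lambda>)"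
  using BSV by (auto simp: affine_BSV_torus_def abelian_variety_def)

private lemma smooth_f: "torus_smooth_on (fst ` \<Lambda>) f (torus (fst ` \<Lambda>))"
  using BSV by (auto simp: affine_BSV_torus_def holomorphic_to_Z_def)

private lemma affine: "affine_connection \<Lambda> D"
  using chern by (simp add: chern_connection_def)

private lemma orthogonal: "orthogonal_complex_structure J0" "orthogonal_complex_structure (f (fst ` p))"
  using BSV fst_p by (auto simp: affine_BSV_torus_def holomorphic_to_Z_def Z_space_def)

private lemma J_linear: "linear J"
  by (auto simp: BSV_J_def linear_iff blinfun.add_right blinfun.scaleR_right split: prod.splits)

private lemma J_J: "J (J x) = - x"
  using orthogonal by (auto simp: BSV_J_def orthogonal_complex_structure_def split: prod.splits)

private lemma J_iso: "J x \<bullet> J y = x \<bullet> y"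
  using orthogonal
  by (auto simp: BSV_J_def orthogonal_complex_structure_def inner_prod_def split: prod.splits)

text \<open>For fixed \<open>y\<close> the field is affine in \<open>f\<close>, through evaluation
  at \<open>snd y\<close>, and \<open>f\<close> is pulled back along \<open>fst\<close>; the chain
  rule does the rest.\<close>

private lemma J_field: "vector_field \<Lambda> (\<lambda>q. BSV_J J0 f q y)"
  and deriv_J: "torus_deriv \<Lambda> (\<lambda>q. BSV_J J0 f q y) p x = (0, blinfun_apply (df (fst x)) (snd y))"
proof -
  let ?L = "\<lambda>F. (0::'h, blinfun_apply F (snd y))"
  have L: "bounded_linear ?L"
    by (intro bounded_linear_Pair bounded_linear_zero blinfun.bounded_linear_left)
  have eq: "(\<lambda>q. BSV_J J0 f q y) = (\<lambda>q. (blinfun_apply J0 (fst y), 0) + ?L (f (fst ` q)))"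
    by (auto simp: BSV_J_def split: prod.splits)
  show "vector_field \<Lambda> (\<lambda>q. BSV_J J0 f q y)"
    unfolding eq vector_field_def
    by (rule torus_smooth_on_affine_comp[OF L torus_smooth_on_fst[OF smooth_f]])
  show "torus_deriv \<Lambda> (\<lambda>q. BSV_J J0 f q y) p x = (0, blinfun_apply (df (fst x)) (snd y))"
    unfolding eq
    by (subst torus_deriv_affine_comp[OF L torus_smooth_on_fst[OF smooth_f]])
      (simp add: torus_deriv_fst[OF lattices smooth_f p])
qed

private lemma connection_skew:
  "D (\<lambda>_. x) (\<lambda>_. y) p \<bullet> w = - (y \<bullet> D (\<lambda>_. x) (\<lambda>_. w) p)"
proof -
  have "torus_deriv \<Lambda> (\<lambda>q. y \<bullet> w) p x
      = D (\<lambda>_. x) (\<lambda>_. y) p \<bullet> w + y \<bullet> D (\<lambda>_. x) (\<lambda>_. w) p"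
    using chern[unfolded chern_connection_def, THEN conjunct2, THEN conjunct1, rule_format,
        OF vector_field_const vector_field_const vector_field_const p] .
  then show ?thesis
    by simp
qed

text \<open>\<open>J\<close> is parallel, but its values on a constant field need not be constant;
  \<open>connection_expand\<close> splits off their derivative, which is the left side.\<close>

private lemma connection_J:
  "(0, blinfun_apply (df (fst x)) (snd y))
     = J (D (\<lambda>_. x) (\<lambda>_. y) p) - D (\<lambda>_. x) (\<lambda>_. J y) p"
proof -
  have "D (\<lambda>_. x) (\<lambda>q. BSV_J J0 f q y) p = J (D (\<lambda>_. x) (\<lambda>_. y) p)"
    using chern[unfolded chern_connection_def, THEN conjunct2, THEN conjunct2, THEN conjunct1,
        rule_format, OF vector_field_const vector_field_const p] .
  then show ?thesis
    using connection_expand[OF affine p J_field, of x y] deriv_J[of y x]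
    by (simp add: algebra_simps)
qed

text \<open>Holomorphicity of \<open>f\<close>: multiplication by i on the tangent spaces of
  \<open>Z_space\<close> is left composition, which is how \<open>J\<close> acts on the vertical
  factor.\<close>

private lemma df_J:
  "(0, blinfun_apply (df (fst (J x))) (snd y)) = J (0, blinfun_apply (df (fst x)) (snd y))"
proof -
  have "df (blinfun_apply J0 (fst x)) = f (fst ` p) o\<^sub>L df (fst x)"
    using BSV fst_p by (auto simp: affine_BSV_torus_def holomorphic_to_Z_def)
  then show ?thesis
    by (cases x) (simp add: BSV_J_def)
qed

private lemmas identities =
  torsion_identities[where T = T and J = J and G = "\<lambda>x y. (0, blinfun_apply (df (fst x)) (snd y))",
    OF bilinear_connection_const[OF affine p] J_linear connection_skew J_iso J_J connection_J df_J
      torsion_at_const chern_torsion_vanishes_11[OF chern p J_linear J_J]]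

lemma BSV_torsion_bilinear: "bilinear T"
proof -
  note b = bilinear_connection_const[OF affine p]
  show ?thesis
    by (auto simp: bilinear_def linear_iff torsion_at_const bilinear_ladd[OF b] bilinear_radd[OF b]
        bilinear_lmul[OF b] bilinear_rmul[OF b] algebra_simps)
qed

private lemma torsion_J: "T (J x) y = J (T x y)" "T x (J y) = J (T x y)"
proof -
  show 1: "T (J x) y = J (T x y)" for x y
    by (rule identities(1))
  show "T x (J y) = J (T x y)"
    using 1[of y x] torsion_at_const[of \<Lambda> D p] linear_neg[OF J_linear] by (metis minus_diff_eq)
qed

private lemma torsion_horizontal: "snd (T y w) = 0"
proof -
  \<comment> \<open>A vertical vector has first component 0, so \<open>f\<close> has zero derivative
    along it.\<close>
  have "(0, k) \<bullet> J (T y w) = 0" for k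
    using identities(2)[of "(0, k)" y w]
    by (simp add: torus_deriv_zero[OF smooth_f] inner_prod_def)
  from this[of "snd (J (T y w))"] have "snd (J (T y w)) = 0"
    by (simp add: inner_prod_def)
  \<comment> \<open>\<open>J\<close> preserves the splitting, so a second application keeps the
    vertical part zero and undoes the first up to sign.\<close>
  then have "snd (J (J (T y w))) = 0"
    by (auto simp: BSV_J_def split: prod.splits)
  then show ?thesis
    by (simp add: J_J)
qed

private lemma torsion_of_horizontal: "T (h, 0) w = 0"
proof -
  \<comment> \<open>The test vector is \<open>J (T (h, 0) w)\<close> itself; the derivative of
    \<open>J\<close> kills \<open>(h, 0)\<close> because it only sees the vertical
    component.\<close>
  have "J (T (h, 0) w) \<bullet> J (T (h, 0) w) = 0"
    by (subst identities(2)) (simp add: inner_prod_def)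
  then show ?thesis
    by (simp add: J_iso)
qed

lemma BSV_im_torsion: "im_torsion (ctorsion_at \<Lambda> D p) (T10 J) \<subseteq> horizontal10 J"
proof
  fix z
  assume "z \<in> im_torsion (ctorsion_at \<Lambda> D p) (T10 J)"
  then obtain N :: nat and v w where z: "z = (\<Sum>a<N. ctorsion_at \<Lambda> D p (v a) (w a))"
    and vw: "\<And>a. a < N \<Longrightarrow> v a \<in> T10 J \<and> w a \<in> T10 J"
    unfolding im_torsion_def by blast
  have eq: "ctorsion_at \<Lambda> D p (v a) (w a)
      = (2 *\<^sub>R T (fst (v a)) (fst (w a)), - (2 *\<^sub>R J (T (fst (v a)) (fst (w a)))))" if "a < N" for a
    unfolding ctorsion_at_def
    using cbilin_T10[OF BSV_torsion_bilinear torsion_J J_linear J_J] vw[OF that] by blast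
  have "ctorsion_at \<Lambda> D p (v a) (w a) \<in> T10 J" if "a < N" for a
    by (simp add: eq[OF that] T10_iff J_J linear_neg[OF J_linear] linear_cmul[OF J_linear])
  then have "z \<in> T10 J"
    unfolding z by (intro T10_sum J_linear) auto
  \<comment> \<open>\<open>J (T x y)\<close> is itself a torsion value, namely
    \<open>T (J x) y\<close>.\<close>
  moreover have "snd (J (T x y)) = 0" for x y
    using torsion_horizontal[of "J x" y] by (simp add: torsion_J)
  then have "snd (fst z) = 0 \<and> snd (snd z) = 0"
    by (simp add: z fst_sum snd_sum eq torsion_horizontal)
  ultimately show "z \<in> horizontal10 J"
    by (auto simp: horizontal10_def horizontal_def mem_Times_iff prod_eq_iff)
qed

text \<open>Real and imaginary parts are both horizontal, so each of the four real torsion terms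
  vanishes.\<close>

lemma BSV_ann_torsion: "horizontal10 J \<subseteq> ann_torsion (ctorsion_at \<Lambda> D p) (T10 J)"
  by (auto simp: horizontal10_def horizontal_def ann_torsion_def ctorsion_at_def cbilin_def
      torsion_of_horizontal zero_prod_def)

end

section \<open>The inclusions at each point and the identity in a unitary frame\<close>

theorem corollary3:
  fixes n r :: nat
    and oV :: "('h::euclidean_space \<times> 'k::euclidean_space) list set"
    and \<Lambda> :: "('h \<times> 'k) set"
    and J0 :: "'h \<Rightarrow>\<^sub>L 'h"
    and f :: "'h set \<Rightarrow> 'k \<Rightarrow>\<^sub>L 'k"
    and D :: "('h \<times> 'k) covd"
  assumes "affine_BSV_torus n r oV \<Lambda> J0 f"
    and "chern_connection \<Lambda> (BSV_J J0 f) D"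
  shows "(\<forall>p\<in>torus \<Lambda>.
            im_torsion (ctorsion_at \<Lambda> D p) (T10 (BSV_J J0 f p)) \<subseteq> horizontal10 (BSV_J J0 f p) \<and>
            horizontal10 (BSV_J J0 f p) \<subseteq> ann_torsion (ctorsion_at \<Lambda> D p) (T10 (BSV_J J0 f p))) \<and>
         (\<forall>U e. unitary_frame n \<Lambda> (BSV_J J0 f) U e \<longrightarrow>
            (\<forall>p\<in>U. \<forall>t :: nat \<Rightarrow> nat \<Rightarrow> nat \<Rightarrow> complex.
               (\<forall>i\<in>{1..n}. \<forall>k\<in>{1..n}.
                  ctorsion_at \<Lambda> D p (e i p) (e k p) = (\<Sum>j=1..n. cscale (t j i k) (e j p))) \<longrightarrow>
               (\<forall>i\<in>{1..n}. \<forall>j\<in>{1..n}. \<forall>k\<in>{1..n}. \<forall>l\<in>{1..n}.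
                  (\<Sum>s=1..n. t l i s * t s j k) = 0)))"
proof (intro conjI ballI allI impI)
  fix p
  assume p: "p \<in> torus \<Lambda>"
  show "im_torsion (ctorsion_at \<Lambda> D p) (T10 (BSV_J J0 f p)) \<subseteq> horizontal10 (BSV_J J0 f p)"
    by (rule BSV_im_torsion[OF assms p])
  show "horizontal10 (BSV_J J0 f p) \<subseteq> ann_torsion (ctorsion_at \<Lambda> D p) (T10 (BSV_J J0 f p))"
    by (rule BSV_ann_torsion[OF assms p])
next
  fix U e p i j k l and t :: "nat \<Rightarrow> nat \<Rightarrow> nat \<Rightarrow> complex"
  assume frame: "unitary_frame n \<Lambda> (BSV_J J0 f) U e" and pU: "p \<in> U"
    and t: "\<forall>i\<in>{1..n}. \<forall>k\<in>{1..n}.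
        ctorsion_at \<Lambda> D p (e i p) (e k p) = (\<Sum>j=1..n. cscale (t j i k) (e j p))"
    and ijkl: "i \<in> {1..n}" "j \<in> {1..n}" "k \<in> {1..n}" "l \<in> {1..n}"
  let ?T = "ctorsion_at \<Lambda> D p"
  have p: "p \<in> torus \<Lambda>"
    using frame pU by (auto simp: unitary_frame_def torus_open_def)
  note b = BSV_torsion_bilinear[OF assms p]
  have e: "e a p \<in> T10 (BSV_J J0 f p)" if "a \<in> {1..n}" for a
    using frame pU that by (auto simp: unitary_frame_def)
  have unitary: "cinner (e a p) (cconj (e l p)) = (if a = l then 1 else 0)" if "a \<in> {1..n}" for a
    using frame pU that ijkl by (auto simp: unitary_frame_def)
  \<comment> \<open>A single product, taken as a sum with \<open>N = Suc 0\<close>.\<close>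
  have "?T (e j p) (e k p) \<in> im_torsion ?T (T10 (BSV_J J0 f p))"
    unfolding im_torsion_def using e ijkl
    by (intro CollectI exI[of _ "Suc 0"] exI[of _ "\<lambda>_. e j p"] exI[of _ "\<lambda>_. e k p"]) auto
  then have "?T (e j p) (e k p) \<in> ann_torsion ?T (T10 (BSV_J J0 f p))"
    using BSV_im_torsion[OF assms p] BSV_ann_torsion[OF assms p] by blast
  then have "?T (?T (e j p) (e k p)) (e i p) = 0"
    using e ijkl by (auto simp: ann_torsion_def)
  \<comment> \<open>The annihilator concerns the first slot; antisymmetry moves the image to the
    second, where its frame expansion produces the required index order.\<close>
  moreover have "?T z w = - ?T w z" for z w
    by (simp add: ctorsion_at_def cbilin_def torsion_at_const)
  ultimately have "0 = ?T (e i p) (?T (e j p) (e k p))"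
    by (metis neg_equal_0_iff_equal)
  also have "\<dots> = ?T (e i p) (\<Sum>s=1..n. cscale (t s j k) (e s p))"
    using t ijkl by simp
  also have "\<dots> = (\<Sum>s=1..n. cscale (t s j k) (?T (e i p) (e s p)))"
    unfolding ctorsion_at_def by (simp add: cbilin_sum_right[OF b] cbilin_cscale_right[OF b])
  also have "\<dots> = (\<Sum>s=1..n. cscale (t s j k) (\<Sum>a=1..n. cscale (t a i s) (e a p)))"
    using t ijkl by simp
  \<comment> \<open>The Hermitian product with \<open>e l p\<close> reads off the coefficient of
    index \<open>l\<close>.\<close>
  finally have "cinner 0 (cconj (e l p))
      = cinner (\<Sum>s=1..n. cscale (t s j k) (\<Sum>a=1..n. cscale (t a i s) (e a p))) (cconj (e l p))"
    by simp
  also have "\<dots> = (\<Sum>s=1..n. t s j k * (\<Sum>a=1..n. t a i s * (if a = l then 1 else 0)))"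
    by (simp add: cinner_sum_left cinner_cscale_left unitary)
  also have "\<dots> = (\<Sum>s=1..n. t l i s * t s j k)"
    using ijkl by (simp add: if_distrib[of "\<lambda>x. _ * x"] mult.commute cong: if_cong)
  finally show "(\<Sum>s=1..n. t l i s * t s j k) = 0"
    by (simp add: cinner_def complex_eq_iff)
qed

end
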